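(* Let $(A,\mathbf{C}^t)$ be a tangled closure algebra with induced closure operator $\mathbf{C}$ and interior operator $\mathbf{I}$, and let $\varGamma\subseteq A$ be finite and non-empty. Then: (1) $\mathbf{C}^t\varGamma$ is closed, i.e. $\mathbf{C}\mathbf{C}^t\varGamma=\mathbf{C}^t\varGamma$. (2) If $\gamma\mapsto\gamma'$ is any function from $\varGamma$ to $A$ and $\varGamma'=\{\gamma':\gamma\in\varGamma\}$, then $$\textstyle\bigwedge_{\gamma\in\varGamma}\mathbf{I}(\gamma\Leftrightarrow\gamma')\leq\mathbf{I}\big(\mathbf{C}^t\varGamma\Leftrightarrow\mathbf{C}^t\varGamma'\big).$$
   Context: Let $A$ be a Boolean algebra with operations $\land,\lor,-,0,1$; write $a\Rightarrow b=-a\lor b$ and $a\Leftrightarrow b=(a\Rightarrow b)\land(b\Rightarrow a)$. A closure operator on $A$ is a map $\mathbf{C}:A\to A$ with $\mathbf{C}(a\lor b)=\mathbf{C}a\lor\mathbf{C}b$, $\mathbf{C}0=0$, $a\leq\mathbf{C}a=\mathbf{C}\mathbf{C}a$; its dual interior operator is $\mathbf{I}a=-\mathbf{C}-a$. Let $\mathcal{P}_{fin}A$ be the set of finite non-empty subsets of $A$. Given $\mathbf{C}^t:\mathcal{P}_{fin}A\to A$, the induced unary map is $\mathbf{C}a=\mathbf{C}^t\{a\}$ and $\mathbf{I}a=-\mathbf{C}^t\{-a\}$. $(A,\mathbf{C}^t)$ is a tangled closure algebra if the induced $\mathbf{C}$ is a closure operator and for all $\varGamma\in\mathcal{P}_{fin}A$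 and $a\in A$: (Fix) $\mathbf{C}^t\varGamma\leq\bigwedge_{\gamma\in\varGamma}\mathbf{C}(\gamma\land\mathbf{C}^t\varGamma)$; (Ind) $\mathbf{I}\big(a\Rightarrow\bigwedge_{\gamma\in\varGamma}\mathbf{C}(\gamma\land a)\big)\land a\leq\mathbf{C}^t\varGamma$. *)

theory Defs
  imports Main
begin

unbundle lattice_syntax

definition bimp :: "'a::boolean_algebra \<Rightarrow> 'a \<Rightarrow> 'a" where
  "bimp a b = - a \<squnion> b"

definition biff :: "'a::boolean_algebra \<Rightarrow> 'a \<Rightarrow> 'a" where
  "biff a b = bimp a b \<sqinter> bimp b a"

definition closure_operator :: "('a::boolean_algebra \<Rightarrow> 'a) \<Rightarrow> bool" where
  "closure_operator C \<longleftrightarrow>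
     (\<forall>a b. C (a \<squnion> b) = C a \<squnion> C b) \<and> C \<bottom> = \<bottom> \<and> (\<forall>a. a \<le> C a \<and> C a = C (C a))"

text \<open>The tangle operation is defined on finite non-empty subsets only. It is modelled by a total
  function on all sets, whose values on empty and on infinite sets are unconstrained and never
  used.\<close>

definition induced_C :: "('a::boolean_algebra set \<Rightarrow> 'a) \<Rightarrow> 'a \<Rightarrow> 'a" where
  "induced_C Ct a = Ct {a}"

definition induced_I :: "('a::boolean_algebra set \<Rightarrow> 'a) \<Rightarrow> 'a \<Rightarrow> 'a" where
  "induced_I Ct a = - Ct {- a}"

definition tangled_closure_algebra :: "('a::boolean_algebra set \<Rightarrow> 'a) \<Rightarrow> bool" where
  "tangled_closure_algebra Ct \<longleftrightarrow>
     closure_operator (induced_C Ct) \<and>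
     (\<forall>\<Gamma>. finite \<Gamma> \<and> \<Gamma> \<noteq> {} \<longrightarrow>
        Ct \<Gamma> \<le> \<Sqinter>\<^sub>f\<^sub>i\<^sub>n ((\<lambda>\<gamma>. induced_C Ct (\<gamma> \<sqinter> Ct \<Gamma>)) ` \<Gamma>)) \<and>
     (\<forall>\<Gamma> a. finite \<Gamma> \<and> \<Gamma> \<noteq> {} \<longrightarrow>
        induced_I Ct (bimp a (\<Sqinter>\<^sub>f\<^sub>i\<^sub>n ((\<lambda>\<gamma>. induced_C Ct (\<gamma> \<sqinter> a)) ` \<Gamma>))) \<sqinter> a \<le> Ct \<Gamma>)"

end

theory Submission
  imports Defs
begin

text \<open>
  Both parts are coinductive: (Ind) says that every \<open>a\<close> with \<open>a \<le> C (\<gamma> \<sqinter> a)\<close> for all \<open>\<gamma> \<in> \<Gamma>\<close>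
  lies below the tangled closure of \<open>\<Gamma>\<close>. For (1), the closure of the tangled closure is such an
  \<open>a\<close>. For (2), let \<open>u\<close> be the given meet of interiors; it is open, so
  \<open>u \<sqinter> C x \<le> C (u \<sqinter> x)\<close>, and below \<open>u\<close> each \<open>\<gamma>\<close> may be replaced by \<open>\<gamma>'\<close> and conversely. Hence the
  meet of \<open>u\<close> with either of the two tangled closures is an admissible \<open>a\<close> for the other one.
\<close>

lemma le_bimp_iff: "u \<le> bimp x y \<longleftrightarrow> u \<sqinter> x \<le> y"
  for u :: "'a::boolean_algebra"
  by (simp add: bimp_def shunt1)

lemma le_biff_iff: "u \<le> biff x y \<longleftrightarrow> u \<sqinter> x \<le> y \<and> u \<sqinter> y \<le> x"
  for u :: "'a::boolean_algebra"
  by (simp add: biff_def le_bimp_iff)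

lemma closure_operator_mono:
  assumes "closure_operator C" and "a \<le> b"
  shows "C a \<le> C b"
  using assms unfolding closure_operator_def by (metis sup.absorb_iff2 sup.cobounded1)

text \<open>The hypothesis on \<open>u\<close> says that it is open. Since \<open>x\<close> lies
  below \<open>- u \<squnion> (u \<sqinter> x)\<close> and \<open>C\<close> fixes
  \<open>- u\<close>, additivity gives the bound after shunting \<open>u\<close> across.\<close>

lemma open_inf_closure_le:
  fixes C :: "'a::boolean_algebra \<Rightarrow> 'a"
  assumes C: "closure_operator C" and u: "C (- u) = - u"
  shows "u \<sqinter> C x \<le> C (u \<sqinter> x)"
proof -
  have "x \<le> - u \<squnion> (u \<sqinter> x)"
    by (simp add: sup_inf_distrib1)
  then have "C x \<le> C (- u \<squnion> (u \<sqinter> x))"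
    by (rule closure_operator_mono [OF C])
  also have "\<dots> = - u \<squnion> C (u \<sqinter> x)"
    using C u by (simp add: closure_operator_def)
  finally show ?thesis
    by (simp add: shunt1 inf.commute [of u "C x"])
qed

locale tangled_closure =
  fixes Ct :: "'a::boolean_algebra set \<Rightarrow> 'a"
  assumes tca: "tangled_closure_algebra Ct"
begin

abbreviation C :: "'a \<Rightarrow> 'a" where "C \<equiv> induced_C Ct"
abbreviation I :: "'a \<Rightarrow> 'a" where "I \<equiv> induced_I Ct"

lemma closure_operator_C: "closure_operator C"
  using tca by (simp add: tangled_closure_algebra_def)

lemmas C_mono = closure_operator_mono [OF closure_operator_C]

lemma C_sup: "C (a \<squnion> b) = C a \<squnion> C b"
  and C_bot: "C \<bottom> = \<bottom>"
  and C_increasing: "a \<le> C a"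
  and C_idem: "C (C a) = C a"
  using closure_operator_C by (simp_all add: closure_operator_def)

lemma I_eq: "I a = - C (- a)"
  by (simp add: induced_I_def induced_C_def)

lemma I_mono: "a \<le> b \<Longrightarrow> I a \<le> I b"
  by (simp add: I_eq C_mono)

lemma I_le: "I a \<le> a"
  using C_increasing [of "- a"] by (simp add: I_eq compl_le_swap2)

lemma I_idem: "I (I a) = I a"
  by (simp add: I_eq C_idem)

lemma I_top: "I \<top> = \<top>"
  by (simp add: I_eq C_bot)

lemma I_inf: "I (a \<sqinter> b) = I a \<sqinter> I b"
  by (simp add: I_eq C_sup)

lemma I_Inf_fin:
  assumes "finite S" and "S \<noteq> {}"
  shows "I (\<Sqinter>\<^sub>f\<^sub>i\<^sub>n S) = \<Sqinter>\<^sub>f\<^sub>i\<^sub>n (I ` S)"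
  using I_inf assms by (rule Inf_fin.hom_commute)

lemma tangle_le:
  assumes "finite \<Gamma>" and "\<gamma> \<in> \<Gamma>"
  shows "Ct \<Gamma> \<le> C (\<gamma> \<sqinter> Ct \<Gamma>)"
proof -
  have "Ct \<Gamma> \<le> \<Sqinter>\<^sub>f\<^sub>i\<^sub>n ((\<lambda>\<gamma>. C (\<gamma> \<sqinter> Ct \<Gamma>)) ` \<Gamma>)"
    using tca assms unfolding tangled_closure_algebra_def by blast
  also have "\<dots> \<le> C (\<gamma> \<sqinter> Ct \<Gamma>)"
    using assms by (intro Inf_fin.coboundedI) auto
  finally show ?thesis .
qed

text \<open>The coinduction rule: when the inequality \<open>a \<le> ?m\<close> holds outright, the
  implication in (Ind) is \<open>\<top>\<close>, so its interior drops out.\<close>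

lemma le_tangleI:
  assumes "finite \<Gamma>" and "\<Gamma> \<noteq> {}" and "\<And>\<gamma>. \<gamma> \<in> \<Gamma> \<Longrightarrow> a \<le> C (\<gamma> \<sqinter> a)"
  shows "a \<le> Ct \<Gamma>"
proof -
  let ?m = "\<Sqinter>\<^sub>f\<^sub>i\<^sub>n ((\<lambda>\<gamma>. C (\<gamma> \<sqinter> a)) ` \<Gamma>)"
  have "a \<le> ?m"
    using assms by (intro Inf_fin.boundedI) auto
  then have "bimp a ?m = \<top>"
    by (intro top_le) (simp add: le_bimp_iff)
  moreover have "I (bimp a ?m) \<sqinter> a \<le> Ct \<Gamma>"
    using tca assms(1,2) unfolding tangled_closure_algebra_def by blast
  ultimately show ?thesis
    by (simp add: I_top)
qed

lemma C_tangle: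
  assumes "finite \<Gamma>" and "\<Gamma> \<noteq> {}"
  shows "C (Ct \<Gamma>) = Ct \<Gamma>"
proof (rule antisym)
  show "C (Ct \<Gamma>) \<le> Ct \<Gamma>"
  proof (rule le_tangleI [OF assms])
    fix \<gamma> assume "\<gamma> \<in> \<Gamma>"
    then have "C (Ct \<Gamma>) \<le> C (C (\<gamma> \<sqinter> Ct \<Gamma>))"
      by (intro C_mono tangle_le assms)
    \<comment> \<open>Idempotence absorbs the outer \<open>C\<close>; the inner tangled closure then
      grows to its own closure.\<close>
    also have "\<dots> \<le> C (\<gamma> \<sqinter> C (Ct \<Gamma>))"
      unfolding C_idem by (intro C_mono inf_mono order_refl C_increasing)
    finally show "C (Ct \<Gamma>) \<le> C (\<gamma> \<sqinter> C (Ct \<Gamma>))" .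
  qed
qed (rule C_increasing)

text \<open>The condition \<open>below\<close> compares the two sets in one direction only, so the
  lemma can be applied to a set and its image in either order.\<close>

lemma open_inf_tangle_le:
  assumes u: "I u = u"
    and fin: "finite \<Gamma>" "finite \<Delta>" "\<Delta> \<noteq> {}"
    and below: "\<And>\<delta>. \<delta> \<in> \<Delta> \<Longrightarrow> \<exists>\<gamma>\<in>\<Gamma>. u \<sqinter> \<gamma> \<le> \<delta>"
  shows "u \<sqinter> Ct \<Gamma> \<le> Ct \<Delta>"
proof (rule le_tangleI [OF fin(2,3)])
  have cu: "C (- u) = - u"
    using u by (metis I_eq double_compl)
  fix \<delta> assume "\<delta> \<in> \<Delta>"
  then obtain \<gamma> where \<gamma>: "\<gamma> \<in> \<Gamma>" "u \<sqinter> \<gamma> \<le> \<delta>"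
    using below by blast
  have "u \<sqinter> Ct \<Gamma> \<le> u \<sqinter> C (\<gamma> \<sqinter> Ct \<Gamma>)"
    by (intro inf_mono order_refl tangle_le fin \<gamma>)
  also have "\<dots> \<le> C (u \<sqinter> (\<gamma> \<sqinter> Ct \<Gamma>))"
    by (rule open_inf_closure_le [OF closure_operator_C cu])
  \<comment> \<open>Here \<open>u\<close> serves twice: with \<open>\<gamma>\<close> it yields
    \<open>\<delta>\<close>, and it is kept as part of the coinductive candidate.\<close>
  also have "\<dots> \<le> C (\<delta> \<sqinter> (u \<sqinter> Ct \<Gamma>))"
    using \<gamma>(2) by (intro C_mono) (simp add: le_infI1 le_infI2 flip: inf_assoc)
  finally show "u \<sqinter> Ct \<Gamma> \<le> C (\<delta> \<sqinter> (u \<sqinter> Ct \<Gamma>))" .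
qed

lemma tangle_replacement:
  assumes "finite \<Gamma>" and "\<Gamma> \<noteq> {}"
  shows "\<Sqinter>\<^sub>f\<^sub>i\<^sub>n ((\<lambda>\<gamma>. I (biff \<gamma> (f \<gamma>))) ` \<Gamma>) \<le> I (biff (Ct \<Gamma>) (Ct (f ` \<Gamma>)))"
proof -
  define u where "u = \<Sqinter>\<^sub>f\<^sub>i\<^sub>n ((\<lambda>\<gamma>. I (biff \<gamma> (f \<gamma>))) ` \<Gamma>)"
  \<comment> \<open>Interior commutes with finite non-empty meets, so \<open>u\<close> is itself an
    interior and hence open.\<close>
  have "u = I (\<Sqinter>\<^sub>f\<^sub>i\<^sub>n ((\<lambda>\<gamma>. biff \<gamma> (f \<gamma>)) ` \<Gamma>))"
    using assms by (simp add: u_def I_Inf_fin image_image)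
  then have u: "I u = u"
    by (simp add: I_idem)
  have "u \<le> biff \<gamma> (f \<gamma>)" if "\<gamma> \<in> \<Gamma>" for \<gamma>
  proof -
    have "u \<le> I (biff \<gamma> (f \<gamma>))"
      unfolding u_def using assms that by (intro Inf_fin.coboundedI) auto
    then show ?thesis
      using I_le by (rule order_trans)
  qed
  then have "u \<sqinter> \<gamma> \<le> f \<gamma>" and "u \<sqinter> f \<gamma> \<le> \<gamma>" if "\<gamma> \<in> \<Gamma>" for \<gamma>
    using that by (simp_all add: le_biff_iff)
  \<comment> \<open>The witnesses for \<open>below\<close> are \<open>\<gamma>\<close> for the
    element \<open>f \<gamma>\<close>, and \<open>f \<gamma>\<close> for the element
    \<open>\<gamma>\<close>.\<close>
  then have "u \<sqinter> Ct \<Gamma> \<le> Ct (f ` \<Gamma>)" and "u \<sqinter> Ct (f ` \<Gamma>) \<le> Ct \<Gamma>"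
    using assms by (auto intro!: open_inf_tangle_le [OF u])
  \<comment> \<open>Both bounds place \<open>u\<close> below the biconditional; as \<open>u\<close>
    is open, monotonicity of \<open>I\<close> carries this to its interior.\<close>
  then have "I u \<le> I (biff (Ct \<Gamma>) (Ct (f ` \<Gamma>)))"
    by (intro I_mono) (simp add: le_biff_iff)
  then show ?thesis
    unfolding u by (simp only: u_def)
qed

end

theorem theorem2p6:
  fixes Ct :: "'a::boolean_algebra set \<Rightarrow> 'a" and \<Gamma> :: "'a set"
  assumes "tangled_closure_algebra Ct" and "finite \<Gamma>" and "\<Gamma> \<noteq> {}"
  shows "induced_C Ct (Ct \<Gamma>) = Ct \<Gamma> \<and>
    (\<forall>f :: 'a \<Rightarrow> 'a.
       \<Sqinter>\<^sub>f\<^sub>i\<^sub>n ((\<lambda>\<gamma>. induced_I Ct (biff \<gamma> (f \<gamma>))) ` \<Gamma>)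
         \<le> induced_I Ct (biff (Ct \<Gamma>) (Ct (f ` \<Gamma>))))"
proof -
  interpret tangled_closure Ct
    by unfold_locales (rule assms(1))
  show ?thesis
    using C_tangle tangle_replacement assms(2,3) by blast
qed

end
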